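(* Consider the selective publication and replication model: $z$ has density $\pi$ on $\mathbb R$; $\hat z\mid z\sim N(z,1)$; the finding is published ($D=1$) with probability $\Pr(D=1\mid \hat z)=s(\hat z)$; and the replication estimate satisfies $\hat z_r\mid z\sim N(z,1)$, conditionally independent of $\hat z$ given $z$. Let $R=\mathbf 1\{|\hat z_r|\ge 1.96 \text{ and } \operatorname{sign}(\hat z_r)=\operatorname{sign}(\hat z)\}$, and for $p\in(0,1)$ let $r(p)=\Pr(R=1\mid \text{two-sided } p\text{-value}=p,\ D=1)$. Suppose $s(\cdot)$ is symmetric about zero and strictly positive. Then for every $p\in(0,1)$, $$ r(p)=\frac{\int_{\mathbb R}\bigl[1-\Phi(1.96-z)\bigr]\,\varphi\left(cv(p)-z\right)\,\widetilde\pi(z)\,dz}{\int_{\mathbb R}\varphi\left(cv(p)-z\right)\,\widetilde\pi(z)\,dz}, $$ where $cv(p)=\Phi^{-1}(1-p/2)$ and $\widetilde\pi(z)=\frac{\pi(z)+\pi(-z)}{2}$.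
   Context: $\Phi$ and $\varphi$ are the standard normal CDF and density. $\pi$ is a probability density on $\mathbb R$ (the distribution of normalized true effects $z$). $s:\mathbb R\to(0,1]$ is a measurable publication probability function; $D$ is a Bernoulli variable equal to 1 if the finding is published, and publication depends only on $\hat z$: given $\hat z$, $D$ is independent of $(z,\hat z_r)$ and $\Pr(D=1\mid\hat z)=s(\hat z)$. The two-sided $p$-value of the original finding is $2(1-\Phi(|\hat z|))$, so conditioning on the $p$-value being $p$ is conditioning on $|\hat z|=cv(p)$. The conditional probability is the usual version obtained from densities: with $x=cv(p)$, $$r(p)=\frac{\int_{\mathbb R}\sum_{\epsilon\in\{-1,1\}}\Pr(R=1\mid \hat z=\epsilon x,z)\,s(\epsilon x)\,\varphi(\epsilon x-z)\,\pi(z)\,dz}{\int_{\mathbb R}\sum_{\epsilon\in\{-1,1\}}s(\epsilon x)\,\varphi(\epsilon x-z)\,\pi(z)\,dz}.$$ *)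

theory Defs
  imports "HOL-Probability.Probability"
begin

definition Phi :: "real \<Rightarrow> real" where
  "Phi = cdf std_normal_distribution"

definition pval :: "real \<Rightarrow> real" where
  "pval x = 2 * (1 - Phi \<bar>x\<bar>)"

text \<open>By \<open>strict_mono_Phi\<close> and \<open>Phi_cv\<close> below, \<open>inv Phi\<close> is the quantile function on \<open>{0<..<1}\<close>.\<close>

definition cv :: "real \<Rightarrow> real" where
  "cv p = inv Phi (1 - p / 2)"

definition replicates :: "real \<Rightarrow> real \<Rightarrow> bool" where
  "replicates x w \<longleftrightarrow> 1.96 \<le> \<bar>w\<bar> \<and> sgn w = sgn x"

text \<open>\<open>Z\<close> is the normalized true effect, \<open>X\<close> the original estimate, \<open>W\<close> the replication estimate and
  \<open>D\<close> the publication indicator.  The joint density is the product of the density of \<open>Z\<close>, of the two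
  conditionally independent \<open>N(z,1)\<close> densities given \<open>Z = z\<close>, and of the Bernoulli probabilities of
  \<open>D\<close>, whose conditional law given \<open>(Z, X, W)\<close> depends on \<open>X\<close> only.\<close>

locale selective_replication = prob_space M for M :: "'a measure" +
  fixes Z X W :: "'a \<Rightarrow> real" and D :: "'a \<Rightarrow> bool"
    and \<pi> s :: "real \<Rightarrow> real"
  assumes pi_nonneg: "\<And>z. 0 \<le> \<pi> z"
    and pi_integral: "has_bochner_integral lborel \<pi> 1"
    and s_measurable: "s \<in> borel_measurable borel"
    and s_nonneg: "\<And>x. 0 \<le> s x"
    and s_le_1: "\<And>x. s x \<le> 1"
    and joint_density:
      "distributed M (lborel \<Otimes>\<^sub>M lborel \<Otimes>\<^sub>M lborel \<Otimes>\<^sub>M count_space UNIV)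
        (\<lambda>\<omega>. (Z \<omega>, X \<omega>, W \<omega>, D \<omega>))
        (\<lambda>(z, x, w, d). ennreal (\<pi> z * normal_density z 1 x * normal_density z 1 w
                                  * (if d then s x else 1 - s x)))"

text \<open>The conditional probability of replication given that the original estimate is \<open>x\<close> and the true
  effect is \<open>z\<close>; by conditional independence the replication estimate still has law \<open>N(z,1)\<close>.\<close>

definition replication_prob :: "real \<Rightarrow> real \<Rightarrow> real" where
  "replication_prob x z = measure (density lborel (normal_density z 1)) {w. replicates x w}"

text \<open>The replication rate given that the \<open>p\<close>-value is \<open>p\<close> and that the finding is published, in the
  version obtained from densities.  Lemma \<open>replication_rate_cond_prob\<close> below confirms that it is
  a version of this conditional probability.\<close>

definition replication_rate :: "(real \<Rightarrow> real) \<Rightarrow> (real \<Rightarrow> real) \<Rightarrow> real \<Rightarrow> real" where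
  "replication_rate \<pi> s p =
    (\<integral>z. (\<Sum>\<epsilon>\<in>{-1, 1}. replication_prob (\<epsilon> * cv p) z * s (\<epsilon> * cv p)
                           * std_normal_density (\<epsilon> * cv p - z) * \<pi> z) \<partial>lborel)
    / (\<integral>z. (\<Sum>\<epsilon>\<in>{-1, 1}. s (\<epsilon> * cv p) * std_normal_density (\<epsilon> * cv p - z) * \<pi> z) \<partial>lborel)"

definition symmetrized :: "(real \<Rightarrow> real) \<Rightarrow> real \<Rightarrow> real" where
  "symmetrized \<pi> z = (\<pi> z + \<pi> (- z)) / 2"


lemma strict_mono_Phi: "strict_mono Phi"
proof (rule strict_monoI)
  fix x y :: real assume xy: "x < y"
  interpret N: real_distribution std_normal_distribution
    by (rule real_dist_normal_dist)
  have "Phi y - Phi x = measure std_normal_distribution {x<..y}"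
    unfolding Phi_def by (rule N.cdf_diff_eq[OF xy])
  moreover have "measure std_normal_distribution {x<..y} \<noteq> 0"
  proof
    assume "measure std_normal_distribution {x<..y} = 0"
    then have "{x<..y} \<in> null_sets std_normal_distribution"
      by (auto simp: null_sets_def N.emeasure_eq_measure)
    then have "AE z in lborel. z \<in> {x<..y} \<longrightarrow> ennreal (std_normal_density z) \<le> 0"
      using null_sets_density_iff[of "\<lambda>z. ennreal (std_normal_density z)" lborel "{x<..y}"] by auto
    then have "AE z in lborel. z \<notin> {x<..y}"
    proof eventually_elim
      case (elim z)
      with normal_density_pos[of 1 0 z] show ?case
        by (simp add: ennreal_eq_0_iff)
    qed
    then have "emeasure lborel {x<..y} = 0"
      using AE_iff_null_sets[of "{x<..y}" lborel] by (auto dest: null_setsD1)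
    with xy show False by simp
  qed
  ultimately show "Phi x < Phi y"
    using measure_nonneg[of std_normal_distribution "{x<..y}"] by linarith
qed

lemma Phi_cv:
  assumes "0 < p" "p < 2"
  shows "Phi (cv p) = 1 - p / 2"
proof -
  interpret N: real_distribution std_normal_distribution
    by (rule real_dist_normal_dist)
  have q: "0 < 1 - p / 2" "1 - p / 2 < 1"
    using assms by auto
  have "measure std_normal_distribution {x} = 0" for x
    by (simp add: measure_def emeasure_density nn_integral_null_set)
  then have cont: "isCont Phi x" for x
    unfolding Phi_def by (simp add: N.isCont_cdf)
  have "\<forall>\<^sub>F x in at_bot. Phi x < 1 - p / 2"
    unfolding Phi_def by (rule order_tendstoD(2)[OF N.cdf_lim_at_bot q(1)])
  then obtain a where a: "Phi a < 1 - p / 2"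
    by (auto simp: eventually_at_bot_linorder)
  have "\<forall>\<^sub>F x in at_top. 1 - p / 2 < Phi x"
    unfolding Phi_def by (rule order_tendstoD(1)[OF N.cdf_lim_at_top_prob q(2)])
  then obtain b where b: "1 - p / 2 < Phi b"
    by (auto simp: eventually_at_top_linorder)
  have "a \<le> b"
    using a b strict_mono_less[OF strict_mono_Phi, of a b] by linarith
  then have "\<exists>x. a \<le> x \<and> x \<le> b \<and> Phi x = 1 - p / 2"
    using a b cont by (intro IVT) auto
  then show ?thesis
    unfolding cv_def by (metis f_inv_into_f rangeI)
qed

lemma cv_pval: "cv (pval x) = \<bar>x\<bar>"
proof -
  have "1 - pval x / 2 = Phi \<bar>x\<bar>"
    by (simp add: pval_def field_simps)
  moreover have "inj Phi"
    using strict_mono_Phi by (rule strict_mono_imp_inj_on)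
  ultimately show ?thesis
    by (simp add: cv_def inv_f_f)
qed

lemma pval_measurable [measurable]: "pval \<in> borel_measurable borel"
proof -
  interpret N: real_distribution std_normal_distribution
    by (rule real_dist_normal_dist)
  have "Phi \<in> borel_measurable borel"
    by (intro borel_measurable_mono strict_mono_mono strict_mono_Phi)
  then show ?thesis
    unfolding pval_def[abs_def] by measurable
qed

lemma replicates_measurable [measurable]:
  "Measurable.pred (borel \<Otimes>\<^sub>M borel) (\<lambda>(x, w). replicates x w)"
  unfolding replicates_def by measurable

lemma replication_prob_nn_integral:
  "ennreal (replication_prob x z) =
    (\<integral>\<^sup>+w. ennreal (normal_density z 1 w) * indicator {w. replicates x w} w \<partial>lborel)"
proof -
  interpret N: prob_space "density lborel (normal_density z 1)"
    by (rule prob_space_normal_density) simp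
  have [measurable]: "{w. replicates x w} \<in> sets borel"
    unfolding replicates_def by measurable
  show ?thesis
    unfolding replication_prob_def
    by (simp add: N.emeasure_eq_measure[symmetric] emeasure_density)
qed

lemma replication_prob_le_1: "replication_prob x z \<le> 1"
proof -
  interpret N: prob_space "density lborel (normal_density z 1)"
    by (rule prob_space_normal_density) simp
  show ?thesis unfolding replication_prob_def by (rule N.prob_le_1)
qed

lemma replication_prob_nonneg: "0 \<le> replication_prob x z"
  by (simp add: replication_prob_def)

lemma normal_density_comp_measurable [measurable (raw)]:
  assumes "f \<in> borel_measurable N" "g \<in> borel_measurable N"
  shows "(\<lambda>\<omega>. normal_density (f \<omega>) 1 (g \<omega>)) \<in> borel_measurable N"
  unfolding normal_density_def using assms by measurable

lemma replication_prob_measurable [measurable]: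
  "(\<lambda>(x, z). replication_prob x z) \<in> borel_measurable (borel \<Otimes>\<^sub>M borel)"
proof -
  have "(\<lambda>(x, z). ennreal (replication_prob x z)) \<in> borel_measurable (borel \<Otimes>\<^sub>M borel)"
    unfolding replication_prob_nn_integral by measurable
  then have "(\<lambda>q. enn2real (case q of (x, z) \<Rightarrow> ennreal (replication_prob x z)))
      \<in> borel_measurable (borel \<Otimes>\<^sub>M borel)"
    by measurable
  then show ?thesis
    by (simp add: case_prod_beta replication_prob_nonneg)
qed

lemma std_normal_density_diff: "std_normal_density (x - z) = normal_density z 1 x"
  by (simp add: normal_density_def)

lemma normal_density_le_1: "normal_density z 1 x \<le> 1"
proof -
  have "1 \<le> sqrt (2 * pi)"
    using pi_ge_two by simp
  moreover have "exp (- ((x - z)\<^sup>2 / 2)) \<le> 1"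
    by simp
  ultimately show ?thesis
    by (auto simp: normal_density_def divide_simps power2_commute intro: order_trans[of _ 1])
qed

context selective_replication
begin

lemma pi_measurable [measurable]: "\<pi> \<in> borel_measurable borel"
  using borel_measurable_has_bochner_integral[OF pi_integral] by simp

lemmas [measurable] = s_measurable

lemma variables_measurable [measurable]:
  shows "X \<in> borel_measurable M" "W \<in> borel_measurable M" "Measurable.pred M D"
proof -
  have *: "(\<lambda>\<omega>. (Z \<omega>, X \<omega>, W \<omega>, D \<omega>)) \<in>
      measurable M (lborel \<Otimes>\<^sub>M lborel \<Otimes>\<^sub>M lborel \<Otimes>\<^sub>M count_space UNIV)"
    using joint_density unfolding distributed_def by blast
  note snd1 = measurable_compose[OF * measurable_snd, unfolded snd_conv]
  note snd2 = measurable_compose[OF snd1 measurable_snd, unfolded snd_conv]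
  show "X \<in> borel_measurable M"
    using measurable_compose[OF snd1 measurable_fst] by simp
  show "W \<in> borel_measurable M"
    using measurable_compose[OF snd2 measurable_fst] by simp
  show "Measurable.pred M D"
    using measurable_compose[OF snd2 measurable_snd] by simp
qed

lemma nn_integral_joint:
  assumes [measurable]: "(\<lambda>(x, w). g x w) \<in> borel_measurable (borel \<Otimes>\<^sub>M borel)"
  shows "(\<integral>\<^sup>+\<omega>. (if D \<omega> then g (X \<omega>) (W \<omega>) else 0) \<partial>M) =
    (\<integral>\<^sup>+x. \<integral>\<^sup>+z. ennreal (\<pi> z * normal_density z 1 x * s x) *
        (\<integral>\<^sup>+w. ennreal (normal_density z 1 w) * g x w \<partial>lborel) \<partial>lborel \<partial>lborel)"
proof -
  interpret C: sigma_finite_measure "count_space (UNIV :: bool set)"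
    by (rule sigma_finite_measure_count_space_finite) simp
  have S1: "sigma_finite_measure ((lborel :: real measure) \<Otimes>\<^sub>M count_space (UNIV :: bool set))"
    by (intro sigma_finite_pair_measure sigma_finite_lborel C.sigma_finite_measure_axioms)
  have S2: "sigma_finite_measure ((lborel :: real measure) \<Otimes>\<^sub>M (lborel :: real measure)
      \<Otimes>\<^sub>M count_space (UNIV :: bool set))"
    by (intro sigma_finite_pair_measure sigma_finite_lborel S1)
  define f where "f = (\<lambda>(z, x, w, d). ennreal (\<pi> z * normal_density z 1 x * normal_density z 1 w
                                  * (if d then s x else 1 - s x)))"
  define h where "h = (\<lambda>(z :: real, x, w, d). if d then g x w else 0)"
  have [measurable]: "h \<in> borel_measurable (lborel \<Otimes>\<^sub>M lborel \<Otimes>\<^sub>M lborel \<Otimes>\<^sub>M count_space UNIV)"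
    unfolding h_def by measurable
  have [measurable]: "f \<in> borel_measurable (lborel \<Otimes>\<^sub>M lborel \<Otimes>\<^sub>M lborel \<Otimes>\<^sub>M count_space UNIV)"
    unfolding f_def by measurable
  have [measurable]: "(\<lambda>q. f q * h q) \<in> borel_measurable (lborel \<Otimes>\<^sub>M lborel \<Otimes>\<^sub>M lborel \<Otimes>\<^sub>M count_space UNIV)"
    by measurable
  have "(\<integral>\<^sup>+\<omega>. (if D \<omega> then g (X \<omega>) (W \<omega>) else 0) \<partial>M) = (\<integral>\<^sup>+\<omega>. h (Z \<omega>, X \<omega>, W \<omega>, D \<omega>) \<partial>M)"
    by (simp add: h_def)
  also have "\<dots> = (\<integral>\<^sup>+q. f q * h q \<partial>(lborel \<Otimes>\<^sub>M lborel \<Otimes>\<^sub>M lborel \<Otimes>\<^sub>M count_space UNIV))"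
    by (rule distributed_nn_integral[symmetric]) (use joint_density in \<open>auto simp: f_def\<close>)
  also have "\<dots> = (\<integral>\<^sup>+z. \<integral>\<^sup>+x. \<integral>\<^sup>+w. \<integral>\<^sup>+d. f (z, x, w, d) * h (z, x, w, d)
      \<partial>count_space UNIV \<partial>lborel \<partial>lborel \<partial>lborel)"
    by (simp add: sigma_finite_measure.nn_integral_fst[OF S2, symmetric]
        sigma_finite_measure.nn_integral_fst[OF S1, symmetric] C.nn_integral_fst[symmetric])
  also have "\<dots> = (\<integral>\<^sup>+z. \<integral>\<^sup>+x. ennreal (\<pi> z * normal_density z 1 x * s x) *
        (\<integral>\<^sup>+w. ennreal (normal_density z 1 w) * g x w \<partial>lborel) \<partial>lborel \<partial>lborel)"
  proof (intro nn_integral_cong)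
    fix z x :: real
    have "(\<integral>\<^sup>+w. \<integral>\<^sup>+d. f (z, x, w, d) * h (z, x, w, d) \<partial>count_space UNIV \<partial>lborel) =
      (\<integral>\<^sup>+w. ennreal (\<pi> z * normal_density z 1 x * s x) * (ennreal (normal_density z 1 w) * g x w) \<partial>lborel)"
    proof (intro nn_integral_cong)
      fix w
      show "(\<integral>\<^sup>+d. f (z, x, w, d) * h (z, x, w, d) \<partial>count_space UNIV) =
        ennreal (\<pi> z * normal_density z 1 x * s x) * (ennreal (normal_density z 1 w) * g x w)"
        by (simp add: nn_integral_count_space_finite UNIV_bool f_def h_def mult.assoc[symmetric]
            ennreal_mult[symmetric] pi_nonneg s_nonneg mult_nonneg_nonneg)
           (simp add: ac_simps)
    qed
    also have "\<dots> = ennreal (\<pi> z * normal_density z 1 x * s x) *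
        (\<integral>\<^sup>+w. ennreal (normal_density z 1 w) * g x w \<partial>lborel)"
      by (rule nn_integral_cmult) measurable
    finally show "(\<integral>\<^sup>+w. \<integral>\<^sup>+d. f (z, x, w, d) * h (z, x, w, d) \<partial>count_space UNIV \<partial>lborel) = \<dots>" .
  qed
  also have "\<dots> = (\<integral>\<^sup>+x. \<integral>\<^sup>+z. ennreal (\<pi> z * normal_density z 1 x * s x) *
        (\<integral>\<^sup>+w. ennreal (normal_density z 1 w) * g x w \<partial>lborel) \<partial>lborel \<partial>lborel)"
    by (rule lborel_pair.Fubini') measurable
  finally show ?thesis .
qed

lemma integrable_num:
  "integrable lborel (\<lambda>z. replication_prob x z * s x' * normal_density z 1 x'' * \<pi> z)"
proof (rule Bochner_Integration.integrable_bound)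
  show "integrable lborel \<pi>" using pi_integral by (rule integrable.intros)
  have "replication_prob x z * s x' * normal_density z 1 x'' \<le> 1 * 1 * 1" for z
    by (intro mult_mono) (auto simp: replication_prob_le_1 replication_prob_nonneg s_nonneg s_le_1 normal_density_le_1)
  then show "AE z in lborel. norm (replication_prob x z * s x' * normal_density z 1 x'' * \<pi> z) \<le> norm (\<pi> z)"
    by (auto simp: abs_mult pi_nonneg s_nonneg replication_prob_nonneg intro!: mult_left_le_one_le)
qed measurable

lemma integrable_den:
  "integrable lborel (\<lambda>z. s x' * normal_density z 1 x'' * \<pi> z)"
proof (rule Bochner_Integration.integrable_bound)
  show "integrable lborel \<pi>" using pi_integral by (rule integrable.intros)
  have "s x' * normal_density z 1 x'' \<le> 1 * 1" for z
    by (intro mult_mono) (auto simp: s_nonneg s_le_1 normal_density_le_1)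
  then show "AE z in lborel. norm (s x' * normal_density z 1 x'' * \<pi> z) \<le> norm (\<pi> z)"
    by (auto simp: abs_mult pi_nonneg s_nonneg intro!: mult_left_le_one_le)
qed measurable

lemma replication_rate_cond_prob:
  assumes A: "A \<in> sets borel"
  shows "prob {\<omega> \<in> space M. pval (X \<omega>) \<in> A \<and> D \<omega> \<and> replicates (X \<omega>) (W \<omega>)} =
    (\<integral>\<omega>. replication_rate \<pi> s (pval (X \<omega>)) * indicator {\<omega>. pval (X \<omega>) \<in> A \<and> D \<omega>} \<omega> \<partial>M)"
proof -
  note [measurable] = A
  define N where "N x = (\<integral>z. replication_prob x z * s x * normal_density z 1 x * \<pi> z \<partial>lborel)" for x
  define E where "E x = (\<integral>z. s x * normal_density z 1 x * \<pi> z \<partial>lborel)" for x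
  define r where "r x = (N x + N (- x)) / (E x + E (- x))" for x
  have N0: "0 \<le> N x" for x unfolding N_def
    by (intro integral_nonneg_AE) (auto simp: replication_prob_nonneg pi_nonneg s_nonneg)
  have E0: "0 \<le> E x" for x unfolding E_def
    by (intro integral_nonneg_AE) (auto simp: pi_nonneg s_nonneg)
  have NE: "N x \<le> E x" for x unfolding N_def E_def
  proof (rule integral_mono[OF integrable_num integrable_den])
    fix z
    show "replication_prob x z * s x * normal_density z 1 x * \<pi> z \<le> s x * normal_density z 1 x * \<pi> z"
      using mult_right_mono[OF replication_prob_le_1[of x z], of "s x * normal_density z 1 x * \<pi> z"]
      by (simp add: pi_nonneg s_nonneg mult.assoc)
  qed
  have [measurable]: "N \<in> borel_measurable borel" "E \<in> borel_measurable borel"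
    unfolding N_def[abs_def] E_def[abs_def] by measurable
  then have [measurable]: "r \<in> borel_measurable borel"
    unfolding r_def[abs_def] by measurable
  have r0: "0 \<le> r x" for x using N0 E0 by (simp add: r_def)
  have req: "r x * (E x + E (- x)) = N x + N (- x)" for x
    using NE[of x] NE[of "- x"] N0[of x] N0[of "- x"] E0[of x] E0[of "- x"]
    by (cases "E x + E (- x) = 0") (auto simp: r_def)
  have r_minus: "r (- x) = r x" for x by (simp add: r_def add.commute)
  have rate: "replication_rate \<pi> s (pval x) = r x" for x
  proof -
    have "replication_rate \<pi> s (pval x) = r \<bar>x\<bar>"
      unfolding replication_rate_def cv_pval std_normal_density_diff r_def N_def E_def
      by (simp add: integrable_num integrable_den add.commute)
    also have "\<dots> = r x" by (cases "x \<ge> 0") (simp_all add: r_minus)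
    finally show ?thesis .
  qed
  have pval_minus: "pval (- x) = pval x" for x by (simp add: pval_def)

  have nnN: "(\<integral>\<^sup>+z. ennreal (\<pi> z * normal_density z 1 x * s x) * ennreal (replication_prob x z) \<partial>lborel)
      = ennreal (N x)" for x
    unfolding N_def
    by (subst nn_integral_eq_integral[OF integrable_num, symmetric])
       (auto simp: pi_nonneg s_nonneg replication_prob_nonneg ennreal_mult[symmetric] ac_simps)
  have nnE: "(\<integral>\<^sup>+z. ennreal (\<pi> z * normal_density z 1 x * s x) \<partial>lborel) = ennreal (E x)" for x
    unfolding E_def
    by (subst nn_integral_eq_integral[OF integrable_den, symmetric])
       (auto simp: pi_nonneg s_nonneg ac_simps)
  have one: "(\<integral>\<^sup>+w. ennreal (normal_density z 1 w) \<partial>lborel) = 1" for z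
    by (simp add: nn_integral_eq_integral)

  have lhs: "emeasure M {\<omega> \<in> space M. pval (X \<omega>) \<in> A \<and> D \<omega> \<and> replicates (X \<omega>) (W \<omega>)}
      = (\<integral>\<^sup>+x. ennreal (N x) * indicator A (pval x) \<partial>lborel)"
  proof -
    have "emeasure M {\<omega> \<in> space M. pval (X \<omega>) \<in> A \<and> D \<omega> \<and> replicates (X \<omega>) (W \<omega>)}
      = (\<integral>\<^sup>+\<omega>. indicator {\<omega> \<in> space M. pval (X \<omega>) \<in> A \<and> D \<omega> \<and> replicates (X \<omega>) (W \<omega>)} \<omega> \<partial>M)"
      by simp
    also have "\<dots> = (\<integral>\<^sup>+\<omega>. (if D \<omega> then indicator A (pval (X \<omega>)) * indicator {w. replicates (X \<omega>) w} (W \<omega>) else 0) \<partial>M)"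
      by (intro nn_integral_cong) (auto simp: indicator_def)
    also have "\<dots> = (\<integral>\<^sup>+x. \<integral>\<^sup>+z. ennreal (\<pi> z * normal_density z 1 x * s x) *
        (\<integral>\<^sup>+w. ennreal (normal_density z 1 w) * (indicator A (pval x) * indicator {w. replicates x w} w) \<partial>lborel) \<partial>lborel \<partial>lborel)"
      by (rule nn_integral_joint) measurable
    also have "\<dots> = (\<integral>\<^sup>+x. ennreal (N x) * indicator A (pval x) \<partial>lborel)"
      by (intro nn_integral_cong)
         (auto simp: indicator_def[of A] nnN[symmetric] replication_prob_nn_integral)
    finally show ?thesis .
  qed

  have rhs: "(\<integral>\<^sup>+\<omega>. ennreal (r (X \<omega>) * indicator {\<omega>. pval (X \<omega>) \<in> A \<and> D \<omega>} \<omega>) \<partial>M)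
      = (\<integral>\<^sup>+x. ennreal (r x * E x) * indicator A (pval x) \<partial>lborel)"
  proof -
    have "(\<integral>\<^sup>+\<omega>. ennreal (r (X \<omega>) * indicator {\<omega>. pval (X \<omega>) \<in> A \<and> D \<omega>} \<omega>) \<partial>M)
      = (\<integral>\<^sup>+\<omega>. (if D \<omega> then ennreal (r (X \<omega>)) * indicator A (pval (X \<omega>)) else 0) \<partial>M)"
      by (intro nn_integral_cong) (auto simp: indicator_def)
    also have "\<dots> = (\<integral>\<^sup>+x. \<integral>\<^sup>+z. ennreal (\<pi> z * normal_density z 1 x * s x) *
        (\<integral>\<^sup>+w. ennreal (normal_density z 1 w) * (ennreal (r x) * indicator A (pval x)) \<partial>lborel) \<partial>lborel \<partial>lborel)"
      by (rule nn_integral_joint) measurable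
    also have "\<dots> = (\<integral>\<^sup>+x. \<integral>\<^sup>+z. ennreal (\<pi> z * normal_density z 1 x * s x) *
        (ennreal (r x) * indicator A (pval x)) \<partial>lborel \<partial>lborel)"
      by (subst nn_integral_multc) (simp_all add: one)
    also have "\<dots> = (\<integral>\<^sup>+x. ennreal (E x) * (ennreal (r x) * indicator A (pval x)) \<partial>lborel)"
      by (subst nn_integral_multc) (simp_all add: nnE)
    also have "\<dots> = (\<integral>\<^sup>+x. ennreal (r x * E x) * indicator A (pval x) \<partial>lborel)"
      by (simp add: ennreal_mult r0 E0 ac_simps)
    finally show ?thesis .
  qed

  have flip: "(\<integral>\<^sup>+x. g x * indicator A (pval x) \<partial>lborel) = (\<integral>\<^sup>+x. g (- x) * indicator A (pval x) \<partial>lborel)"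
    if [measurable]: "g \<in> borel_measurable borel" for g :: "real \<Rightarrow> ennreal"
    by (subst nn_integral_real_affine[where c = "-1" and t = 0]) (auto simp: pval_minus)
  have double: "2 * (\<integral>\<^sup>+x. ennreal (h x) * indicator A (pval x) \<partial>lborel) =
      (\<integral>\<^sup>+x. ennreal (h x + h (- x)) * indicator A (pval x) \<partial>lborel)"
    if [measurable]: "h \<in> borel_measurable borel" and h0: "\<And>x. 0 \<le> h x" for h :: "real \<Rightarrow> real"
  proof -
    have "2 * (\<integral>\<^sup>+x. ennreal (h x) * indicator A (pval x) \<partial>lborel) =
      (\<integral>\<^sup>+x. ennreal (h x) * indicator A (pval x) \<partial>lborel) + (\<integral>\<^sup>+x. ennreal (h (- x)) * indicator A (pval x) \<partial>lborel)"
      using flip[of "\<lambda>x. ennreal (h x)"] by (simp add: mult_2)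
    also have "\<dots> = (\<integral>\<^sup>+x. ennreal (h x) * indicator A (pval x) + ennreal (h (- x)) * indicator A (pval x) \<partial>lborel)"
      by (rule nn_integral_add[symmetric]) measurable
    finally show ?thesis by (simp add: h0 distrib_right)
  qed
  have "2 * (\<integral>\<^sup>+x. ennreal (N x) * indicator A (pval x) \<partial>lborel)
      = 2 * (\<integral>\<^sup>+x. ennreal (r x * E x) * indicator A (pval x) \<partial>lborel)"
    using double[of N] double[of "\<lambda>x. r x * E x"]
    by (simp add: N0 E0 r0 r_minus req[symmetric] distrib_left)
  then have eq: "(\<integral>\<^sup>+x. ennreal (N x) * indicator A (pval x) \<partial>lborel)
      = (\<integral>\<^sup>+x. ennreal (r x * E x) * indicator A (pval x) \<partial>lborel)"
    by (simp add: ennreal_mult_cancel_left)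
  have "(\<integral>\<omega>. replication_rate \<pi> s (pval (X \<omega>)) * indicator {\<omega>. pval (X \<omega>) \<in> A \<and> D \<omega>} \<omega> \<partial>M)
      = enn2real (\<integral>\<^sup>+\<omega>. ennreal (r (X \<omega>) * indicator {\<omega>. pval (X \<omega>) \<in> A \<and> D \<omega>} \<omega>) \<partial>M)"
    unfolding rate by (rule integral_eq_nn_integral) (auto simp: r0 indicator_def)
  also have "\<dots> = enn2real (emeasure M {\<omega> \<in> space M. pval (X \<omega>) \<in> A \<and> D \<omega> \<and> replicates (X \<omega>) (W \<omega>)})"
    by (simp only: lhs rhs eq)
  finally show ?thesis by (simp add: measure_def)
qed

end

end

(* Reflecting z and w turns the branch of negative estimates into that of positive estimates with
   \<pi>(-z) in place of \<pi>(z).  Since s has the same value at both estimates cv p and -cv p, it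
   factors out of numerator and denominator and cancels, leaving twice the symmetrized density. *)
theory Submission
  imports Defs
begin

text \<open>The substitution \<open>t + e * w\<close> for \<open>w\<close> has Jacobian 1 and
  carries one unit-variance normal density to another. The choice \<open>e = 1\<close>,
  \<open>t = z\<close> centers the law; \<open>e = -1\<close>, \<open>t = 0\<close> reflects
  it.\<close>

lemma emeasure_normal_affine:
  assumes [measurable]: "A \<in> sets borel" and e: "\<bar>e\<bar> = 1"
  shows "emeasure (density lborel (normal_density z 1)) A =
    emeasure (density lborel (normal_density (e * (z - t)) 1)) ((\<lambda>w. t + e * w) -` A)"
proof -
  have sq: "e * e = 1"
    using e abs_mult_self_eq[of e] by simp
  have [measurable]: "(\<lambda>w. t + e * w) -` A \<in> sets borel"
    by (rule measurable_sets_borel[of _ borel]) auto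
  have shift: "normal_density z 1 (t + e * w) = normal_density (e * (z - t)) 1 w" for w
  proof -
    \<comment> \<open>Since \<open>e * e = 1\<close>, the base on the left is \<open>e\<close> times
      the base on the right.\<close>
    have "(t + e * w - z)\<^sup>2 = (e * e) * (w - e * (z - t))\<^sup>2"
      using sq by algebra
    then show ?thesis
      by (simp add: normal_density_def sq)
  qed
  have "emeasure (density lborel (normal_density z 1)) A =
      (\<integral>\<^sup>+w. ennreal (normal_density z 1 w) * indicator A w \<partial>lborel)"
    by (simp add: emeasure_density)
  also have "\<dots> = (\<integral>\<^sup>+w. ennreal (normal_density (e * (z - t)) 1 w)
      * indicator ((\<lambda>w. t + e * w) -` A) w \<partial>lborel)"
    using e by (subst nn_integral_real_affine[where c = e and t = t])
      (auto simp: shift indicator_def)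
  also have "\<dots> = emeasure (density lborel (normal_density (e * (z - t)) 1)) ((\<lambda>w. t + e * w) -` A)"
    by (simp add: emeasure_density)
  finally show ?thesis .
qed

lemma normal_atLeast:
  "measure (density lborel (normal_density z 1)) {a..} = 1 - Phi (a - z)"
proof -
  interpret N: real_distribution std_normal_distribution
    by (rule real_dist_normal_dist)
  have null: "measure std_normal_distribution {a - z} = 0"
    by (simp add: measure_def emeasure_density nn_integral_null_set)
  have "measure (density lborel (normal_density z 1)) {a..} = measure std_normal_distribution {a - z..}"
    using emeasure_normal_affine[of "{a..}" 1 z z]
    by (auto simp: measure_def vimage_def atLeast_def algebra_simps)
  \<comment> \<open>\<open>Phi\<close> measures closed left half-lines, whose complements are open;
    the missing endpoint is added back as a null set.\<close>
  also have "{a - z..} = {a - z} \<union> (space std_normal_distribution - {..a - z})"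
    by auto
  also have "measure std_normal_distribution \<dots> = 1 - Phi (a - z)"
    using null by (subst N.finite_measure_Union) (auto simp: N.prob_compl[simplified] Phi_def cdf_def)
  finally show ?thesis .
qed

text \<open>Reflection swaps the two half-lines at 0, so \<open>Phi 0 = 1 - Phi 0\<close>.\<close>

lemma Phi_zero: "Phi 0 = 1 / 2"
proof -
  have "measure std_normal_distribution {0..} = measure std_normal_distribution {..0}"
    using emeasure_normal_affine[of "{0..}" "-1" 0 0]
    by (simp add: measure_def vimage_def atLeast_def atMost_def)
  then show ?thesis
    using normal_atLeast[of 0 0] by (simp add: Phi_def cdf_def)
qed

text \<open>For \<open>p < 1\<close> the level \<open>1 - p / 2\<close> exceeds
  \<open>1 / 2 = Phi 0\<close>. Positivity decides which sign a replication must have.\<close>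

lemma cv_pos:
  assumes "0 < p" "p < 1"
  shows "0 < cv p"
proof -
  have "Phi 0 < Phi (cv p)"
    using assms by (simp add: Phi_cv Phi_zero)
  then show ?thesis
    by (simp add: strict_mono_less[OF strict_mono_Phi])
qed

text \<open>Agreement with a positive sign leaves only the upper tail of the two-sided
  condition.\<close>

lemma replication_prob_pos:
  assumes "0 < x"
  shows "replication_prob x z = 1 - Phi (1.96 - z)"
proof -
  have "{w. replicates x w} = {1.96..}"
    using assms by (auto simp: replicates_def sgn_if)
  then show ?thesis
    by (simp only: replication_prob_def normal_atLeast)
qed

text \<open>\<open>replicates\<close> is unchanged when both estimates change sign, and reflection
  turns the law N(z,1) into N(-z,1).\<close>

lemma replication_prob_minus: "replication_prob (- x) z = replication_prob x (- z)"
proof -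
  have [measurable]: "{w. replicates (- x) w} \<in> sets borel"
    unfolding replicates_def by measurable
  have "(\<lambda>w. - w) -` {w. replicates (- x) w} = {w. replicates x w}"
    by (auto simp: replicates_def sgn_minus)
  then show ?thesis
    using emeasure_normal_affine[of "{w. replicates (- x) w}" "-1" z 0]
    by (simp add: replication_prob_def measure_def)
qed

text \<open>Substituting \<open>- z\<close> for \<open>z\<close> in the second summand moves the
  reflection from the weight \<open>f\<close> to the density \<open>\<pi>\<close>.\<close>

lemma integral_symmetrized:
  assumes "integrable lborel (\<lambda>z. f z * \<pi> z)" and "integrable lborel (\<lambda>z. f (- z) * \<pi> z)"
  shows "(\<integral>z. (f z + f (- z)) * \<pi> z \<partial>lborel) = 2 * (\<integral>z. f z * symmetrized \<pi> z \<partial>lborel)"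
proof -
  have reflect: "integrable lborel (\<lambda>z. f z * \<pi> (- z))"
    using lborel_integrable_real_affine[OF assms(2), of "-1" 0] by simp
  have "(\<integral>z. f (- z) * \<pi> z \<partial>lborel) = (\<integral>z. f z * \<pi> (- z) \<partial>lborel)"
    using lborel_integral_real_affine[of "-1" "\<lambda>z. f (- z) * \<pi> z" 0] by simp
  then have "(\<integral>z. (f z + f (- z)) * \<pi> z \<partial>lborel) =
      (\<integral>z. f z * \<pi> z \<partial>lborel) + (\<integral>z. f z * \<pi> (- z) \<partial>lborel)"
    using assms by (simp add: distrib_right)
  also have "\<dots> = (\<integral>z. f z * \<pi> z + f z * \<pi> (- z) \<partial>lborel)"
    by (rule Bochner_Integration.integral_add[OF assms(1) reflect, symmetric])
  also have "\<dots> = (\<integral>z. 2 * (f z * symmetrized \<pi> z) \<partial>lborel)"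
    by (rule Bochner_Integration.integral_cong) (simp_all add: symmetrized_def field_simps)
  also have "\<dots> = 2 * (\<integral>z. f z * symmetrized \<pi> z \<partial>lborel)"
    by (rule integral_mult_right_zero)
  finally show ?thesis .
qed

theorem theorem1:
  fixes M :: "'a measure" and Z X W :: "'a \<Rightarrow> real" and D :: "'a \<Rightarrow> bool"
    and \<pi> s :: "real \<Rightarrow> real" and p :: real
  assumes model: "selective_replication M Z X W D \<pi> s"
    and s_symmetric: "\<And>x. s (- x) = s x"
    and s_pos: "\<And>x. 0 < s x"
    and p: "0 < p" "p < 1"
  shows "replication_rate \<pi> s p =
    (\<integral>z. (1 - Phi (1.96 - z)) * std_normal_density (cv p - z) * symmetrized \<pi> z \<partial>lborel)
    / (\<integral>z. std_normal_density (cv p - z) * symmetrized \<pi> z \<partial>lborel)"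
proof -
  interpret selective_replication M Z X W D \<pi> s
    by (rule model)
  define c where "c = cv p"
  have c: "0 < c"
    using cv_pos[OF p] by (simp add: c_def)
  \<comment> \<open>\<open>g\<close> and \<open>f\<close> are the weights of the branch at
    \<open>c\<close> in denominator and numerator, without the factor \<open>s c\<close>; the branch
    at \<open>- c\<close> has the weights \<open>g (- z)\<close> and \<open>f (- z)\<close>.\<close>
  define g where "g z = std_normal_density (c - z)" for z
  define f where "f z = replication_prob c z * g z" for z
  have g_minus: "std_normal_density (- c - z) = g (- z)" for z
    using power2_minus[of "c + z"] by (simp add: g_def normal_density_def)
  have s_nz: "s c \<noteq> 0"
    using s_pos[of c] by simp
  have dens: "normal_density z 1 c = g z" "normal_density z 1 (- c) = g (- z)" for z
    unfolding g_minus[symmetric] unfolding g_def by (rule std_normal_density_diff[symmetric])+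
  \<comment> \<open>The model gives integrability with the factor \<open>s c\<close>, which can be
    divided out because it is nonzero.\<close>
  have int_g: "integrable lborel (\<lambda>z. g z * \<pi> z)" "integrable lborel (\<lambda>z. g (- z) * \<pi> z)"
    using integrable_den[of c c] integrable_den[of c "- c"] s_nz
    by (simp_all add: dens mult.assoc)
  have int_f: "integrable lborel (\<lambda>z. f z * \<pi> z)" "integrable lborel (\<lambda>z. f (- z) * \<pi> z)"
    using integrable_num[of c c c] integrable_num[of "- c" c "- c"] s_nz
    by (simp_all add: dens f_def replication_prob_minus mult.assoc mult.left_commute[of _ "s c"])
  have "replication_rate \<pi> s p =
      (\<integral>z. s c * ((f z + f (- z)) * \<pi> z) \<partial>lborel) / (\<integral>z. s c * ((g z + g (- z)) * \<pi> z) \<partial>lborel)"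
    unfolding replication_rate_def c_def[symmetric]
    by (simp add: s_symmetric g_minus g_def[symmetric] f_def replication_prob_minus algebra_simps)
  \<comment> \<open>Numerator and denominator share the nonzero factor
    \<open>2 * s c\<close>.\<close>
  also have "\<dots> = (\<integral>z. f z * symmetrized \<pi> z \<partial>lborel) / (\<integral>z. g z * symmetrized \<pi> z \<partial>lborel)"
    using s_nz by (simp add: integral_symmetrized[OF int_f] integral_symmetrized[OF int_g])
  finally show ?thesis
    by (simp add: f_def g_def c_def[symmetric] replication_prob_pos[OF c])
qed

end
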